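(* There are universal constants $c_1,c_2>0$ such that for all reals $0<\varepsilon_1,\varepsilon_2<1$ and every finite set $X\subset\mathbb{R}^2$ of diameter at most $1$ with $|X|\ge c_1\varepsilon_1^{-2}$ the following holds: $$|\mathcal{N}_{\varepsilon_1}(X)|\ \ge\ \begin{cases} c_2\,\varepsilon_1^{2}\,\varepsilon_2^{-3/2}\,|\mathcal{A}_{\varepsilon_2}(X)|, & \text{if } \varepsilon_1\le\varepsilon_2,\\ c_2\,\varepsilon_1^{1/2}\,|\mathcal{A}_{\varepsilon_2}(X)|, & \text{if } \varepsilon_1>\varepsilon_2.\end{cases}$$
   Context: For a finite set $X\subset\mathbb{R}^2$ and $0<\varepsilon<1$, with $\|\cdot\|$ the Euclidean norm, $\mathcal{A}_\varepsilon(X)$ is the set of unordered pairs $\{x,y\}\subset X$ of distinct points with $\|x-y\|\ge 1-\varepsilon$ ($\varepsilon$-antipodal pairs), and $\mathcal{N}_\varepsilon(X)$ is the set of unordered pairs $\{x,y\}\subset X$ of distinct points with $\|x-y\|\le\varepsilon$ ($\varepsilon$-neighboring pairs). *)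

theory Defs
  imports "HOL-Analysis.Analysis"
begin

text \<open>Unordered pairs of distinct points are represented as two-element sets.\<close>

definition antipodal_pairs :: "real \<Rightarrow> (real^2) set \<Rightarrow> (real^2) set set" where
  "antipodal_pairs \<epsilon> X = {{x, y} | x y. x \<in> X \<and> y \<in> X \<and> x \<noteq> y \<and> norm (x - y) \<ge> 1 - \<epsilon>}"

definition neighboring_pairs :: "real \<Rightarrow> (real^2) set \<Rightarrow> (real^2) set set" where
  "neighboring_pairs \<epsilon> X = {{x, y} | x y. x \<in> X \<and> y \<in> X \<and> x \<noteq> y \<and> norm (x - y) \<le> \<epsilon>}"

end

theory Submission
  imports Defs
begin

text \<open>
  Only \<open>\<epsilon>\<^sub>1 = \<epsilon>\<^sub>2 = \<epsilon>\<close> is essential. For \<open>\<epsilon>\<^sub>1 > \<epsilon>\<^sub>2\<close> one enlarges \<open>\<epsilon>\<^sub>2\<close>, and for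
  \<open>\<epsilon>\<^sub>1 < \<epsilon>\<^sub>2\<close> the pigeonhole principle, applied inside clusters of diameter \<open>\<epsilon>\<^sub>2\<close>, shows that
  passing to the smaller scale costs at most a factor of order \<open>(\<epsilon>\<^sub>1 / \<epsilon>\<^sub>2)\<^sup>2\<close>.

  Choose an \<open>\<epsilon>\<close>-net \<open>P\<close> of \<open>X\<close> and let \<open>w p\<close> be the number of points assigned to \<open>p\<close>. Close pairs
  number at least about \<open>\<Sum>p. (w p)\<^sup>2\<close> (when diagonal pairs are counted too; these are absorbed because
  \<open>X\<close> is large), and antipodal pairs at most \<open>\<Sum> w p w q\<close> over the edges of the graph joining
  net points at distance almost \<open>1\<close>. So the claim is that the adjacency matrix of this graph has
  norm \<open>O(1 / \<surd>\<epsilon>)\<close>. Degrees may be as large as \<open>1 / \<epsilon>\<close>, and the bound is attained by a star: one point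
  joined to the \<open>1 / \<epsilon>\<close> net points of a unit arc around it.

  The reason for the bound is the geometric fact \<open>opposite_chords\<close>: if \<open>x y\<close> is an edge, and \<open>y'\<close> is
  a neighbor of \<open>x\<close> and \<open>x'\<close> a neighbor of \<open>y\<close>, obtained by turning the edge in the same sense,
  then \<open>\<bar>x' - x\<bar> \<bar>y' - y\<bar> = O(\<epsilon>)\<close>, for otherwise \<open>x'\<close> and \<open>y'\<close> would be more than \<open>1\<close> apart. As the
  neighbors of a vertex lie in a thin annulus, many of them cannot all be close to one of them
  (\<open>card_arc_le\<close>). Thus if \<open>y\<close> has rank \<open>k\<close> among the neighbors of \<open>x\<close>, counted from one end of their arc,
  then \<open>y\<close> has only \<open>O(1 / (\<epsilon> k))\<close> neighbors on the corresponding side of \<open>x\<close>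
  (\<open>card_side_mult_le\<close>). Summing the square roots of these bounds over \<open>k\<close> shows that the
  square root of the degree is a test function for Schur's test (\<open>sum_sqrt_degree_le\<close>,
  \<open>schur_test\<close>), without any logarithmic loss.
\<close>

section \<open>The planar cross product\<close>

definition cross2 :: "real^2 \<Rightarrow> real^2 \<Rightarrow> real" where
  "cross2 u v = u$1 * v$2 - u$2 * v$1"

lemma inner2: "(u::real^2) \<bullet> v = u$1 * v$1 + u$2 * v$2"
  by (simp add: inner_vec_def sum_2)

text \<open>The planar case of the Binet--Cauchy identity. It converts information on the components of two
  vectors along and across fixed directions into information on their inner product.\<close>

lemma cross2_inner_identity:
  "(u \<bullet> v) * (p \<bullet> q) = (u \<bullet> p) * (v \<bullet> q) + cross2 u q * cross2 v p"
  unfolding inner2 cross2_def by algebra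

lemma cross2_exchange:
  "(u \<bullet> u) * cross2 p q = (u \<bullet> p) * cross2 u q - (u \<bullet> q) * cross2 u p"
  unfolding inner2 cross2_def by algebra

lemma cross2_sq: "(cross2 u v)\<^sup>2 = (u \<bullet> u) * (v \<bullet> v) - (u \<bullet> v)\<^sup>2"
  unfolding inner2 cross2_def by algebra

lemma abs_cross2_le: "\<bar>cross2 u v\<bar> \<le> norm u * norm v"
proof -
  have "(cross2 u v)\<^sup>2 \<le> (norm u * norm v)\<^sup>2"
    by (simp add: cross2_sq power_mult_distrib flip: power2_norm_eq_inner)
  then show ?thesis by (simp add: abs_le_square_iff[symmetric] abs_mult)
qed

lemma cross2_diff_right: "cross2 u (p - q) = cross2 u p - cross2 u q"
  by (simp add: cross2_def algebra_simps)

lemma cross2_self [simp]: "cross2 u u = 0"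
  by (simp add: cross2_def)

section \<open>Chords of a thin annulus\<close>

lemma norm_in_annulus_sq:
  fixes v :: "'a::real_inner"
  assumes "1 - \<epsilon> \<le> norm v" "norm v \<le> 1" "\<epsilon> \<le> 1"
  shows "1 - 2 * \<epsilon> \<le> v \<bullet> v" "v \<bullet> v \<le> 1"
proof -
  have "(1 - \<epsilon>)\<^sup>2 \<le> (norm v)\<^sup>2" using assms by (intro power_mono) auto
  moreover have "(1 - \<epsilon>)\<^sup>2 = 1 - 2 * \<epsilon> + \<epsilon>\<^sup>2" by (simp add: power2_diff)
  moreover have "0 \<le> \<epsilon>\<^sup>2" by simp
  ultimately show "1 - 2 * \<epsilon> \<le> v \<bullet> v"
    unfolding power2_norm_eq_inner by linarith
  show "v \<bullet> v \<le> 1"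
    using power_mono[of "norm v" 1 2] assms by (simp add: power2_norm_eq_inner[symmetric])
qed

text \<open>Both ends of the chord \<open>a\<close> are at distance almost \<open>1\<close> from the origin, so the chord bends inwards:
  its component along \<open>v\<close> is \<open>- \<bar>a\<bar>\<^sup>2 / 2\<close> up to \<open>\<epsilon>\<close>, as for a chord of the unit circle.\<close>

lemma inner_chord_bounds:
  fixes v a :: "'a::real_inner"
  assumes "1 - \<epsilon> \<le> norm v" "norm v \<le> 1" "1 - \<epsilon> \<le> norm (v + a)" "norm (v + a) \<le> 1" "\<epsilon> \<le> 1"
  shows "- (a \<bullet> a) / 2 - \<epsilon> \<le> v \<bullet> a" "v \<bullet> a \<le> \<epsilon> - (a \<bullet> a) / 2"
proof -
  have "(v + a) \<bullet> (v + a) = v \<bullet> v + 2 * (v \<bullet> a) + a \<bullet> a"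
    by (simp add: inner_add_left inner_add_right inner_commute)
  then show "- (a \<bullet> a) / 2 - \<epsilon> \<le> v \<bullet> a" "v \<bullet> a \<le> \<epsilon> - (a \<bullet> a) / 2"
    using norm_in_annulus_sq[OF assms(1,2,5)] norm_in_annulus_sq[OF assms(3,4,5)] by linarith+
qed

text \<open>A chord of length at most \<open>1\<close> of a unit circle makes an angle of at most \<open>30\<close> degrees with the
  tangent at its end. Hence a chord long compared with the width of the annulus has a
  definite proportion of its length in the tangential direction, which \<open>cross2 v\<close> measures.\<close>

lemma chord_le_cross2:
  fixes v a :: "real^2"
  assumes "\<epsilon> \<le> 1/10" "1 - \<epsilon> \<le> norm v" "norm v \<le> 1"
    "1 - \<epsilon> \<le> norm (v + a)" "norm (v + a) \<le> 1" "norm a \<le> 1" "10 * \<epsilon> \<le> norm a"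
  shows "2/3 * norm a \<le> \<bar>cross2 v a\<bar>"
proof -
  have aa: "a \<bullet> a \<le> norm a"
    using assms(6) mult_left_le[of "norm a" "norm a"] by (simp add: dot_square_norm power2_eq_square)
  have "\<bar>v \<bullet> a\<bar> \<le> 6/10 * norm a"
    using inner_chord_bounds[OF assms(2-5)] assms(6,7) aa inner_ge_zero[of a]
    unfolding abs_le_iff by linarith
  then have "(v \<bullet> a)\<^sup>2 \<le> (6/10 * norm a)\<^sup>2"
    using power_mono[of "\<bar>v \<bullet> a\<bar>" _ 2] by simp
  then have 1: "(v \<bullet> a)\<^sup>2 \<le> 36/100 * (norm a)\<^sup>2" by (simp add: power_mult_distrib power2_eq_square)
  have "(9/10)\<^sup>2 \<le> (norm v)\<^sup>2" using assms by (intro power_mono) auto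
  then have "81/100 * (norm a)\<^sup>2 \<le> (norm v)\<^sup>2 * (norm a)\<^sup>2"
    by (intro mult_right_mono) (auto simp: power2_eq_square)
  with 1 have "(2/3 * norm a)\<^sup>2 \<le> (cross2 v a)\<^sup>2"
    unfolding cross2_sq power_mult_distrib power2_norm_eq_inner
    using inner_ge_zero[of a] by (simp add: power2_eq_square[of "2/3::real"] del: inner_ge_zero)
  then show ?thesis by (simp add: abs_le_square_iff[symmetric] abs_mult)
qed

text \<open>The geometric heart of the proof. Suppose \<open>x y\<close>, \<open>x y'\<close> and \<open>y x'\<close> are almost diameters, with
  \<open>y'\<close> and \<open>x'\<close> reached from \<open>y\<close> and \<open>x\<close> by turning the segment in the same sense about its other
  end. Then \<open>x'\<close> and \<open>y'\<close> move to opposite sides of the line \<open>x y\<close> and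
  drift apart: \<open>\<bar>x' - y'\<bar>\<^sup>2\<close> would exceed \<open>1\<close> by an amount of order \<open>\<bar>a\<bar> \<bar>b\<bar>\<close>, where \<open>a = y' - y\<close> and \<open>b = x' - x\<close>.
  As it may not exceed \<open>1\<close>, the product of the two displacements is \<open>O(\<epsilon>)\<close>. This is a
  quantitative form of the fact that two diameters of a planar set must meet.

  Exactly: the alternating sum of the four squared distances between \<open>{x, x'}\<close> and \<open>{y, y'}\<close> is
  \<open>- 2 (a \<bullet> b)\<close>, so \<open>a \<bullet> b \<ge> - 2 \<epsilon>\<close>; on the other hand the components of \<open>a\<close> and \<open>b\<close> across \<open>x y\<close>
  have opposite orientation and sizes of order \<open>\<bar>a\<bar>\<close> and \<open>\<bar>b\<bar>\<close> (\<open>chord_le_cross2\<close>), and the components along \<open>x y\<close>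
  contribute at most \<open>\<epsilon>\<close> to \<open>a \<bullet> b\<close>.\<close>

lemma opposite_chords:
  fixes x y x' y' :: "real^2"
  assumes e: "0 < \<epsilon>" "\<epsilon> \<le> 1/10"
    and edges: "1 - \<epsilon> \<le> norm (y - x)" "1 - \<epsilon> \<le> norm (y' - x)" "1 - \<epsilon> \<le> norm (x' - y)"
    and diam: "norm (y - x) \<le> 1" "norm (y' - x) \<le> 1" "norm (x' - y) \<le> 1" "norm (y' - x') \<le> 1"
      "norm (x' - x) \<le> 1" "norm (y' - y) \<le> 1"
    and side: "cross2 (y - x) (y' - x) * cross2 (x - y) (x' - y) \<ge> 0"
  shows "norm (x' - x) * norm (y' - y) \<le> 10 * \<epsilon>"
proof (cases "10 * \<epsilon> \<le> norm (x' - x) \<and> 10 * \<epsilon> \<le> norm (y' - y)")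
  case False
  then show ?thesis
    using mult_mono[of "norm (x' - x)" "10 * \<epsilon>" "norm (y' - y)" 1]
      mult_mono[of "norm (x' - x)" 1 "norm (y' - y)" "10 * \<epsilon>"] diam e by auto
next
  case True
  define v a b where "v = y - x" and "a = y' - y" and "b = x' - x"
  have va: "v + a = y' - x" and vb: "- v + b = x' - y" by (simp_all add: v_def a_def b_def)
  have nv: "1 - \<epsilon> \<le> norm v" "norm v \<le> 1" "1 - \<epsilon> \<le> norm (- v)" "norm (- v) \<le> 1" and e1: "\<epsilon> \<le> 1"
    using edges diam e by (simp_all add: v_def norm_minus_commute)
  have nva: "1 - \<epsilon> \<le> norm (v + a)" "norm (v + a) \<le> 1" and nvb: "1 - \<epsilon> \<le> norm (- v + b)" "norm (- v + b) \<le> 1"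
    using edges diam unfolding va vb by auto
  have ab: "norm a \<le> 1" "norm b \<le> 1" "10 * \<epsilon> \<le> norm a" "10 * \<epsilon> \<le> norm b"
    using True diam by (simp_all add: a_def b_def)
  have "cross2 v a * cross2 v b \<le> 0"
    using side by (simp add: cross2_def v_def a_def b_def algebra_simps)
  moreover have "2/3 * norm a * (2/3 * norm b) \<le> \<bar>cross2 v a\<bar> * \<bar>cross2 v b\<bar>"
  proof (rule mult_mono)
    show "2/3 * norm a \<le> \<bar>cross2 v a\<bar>" by (rule chord_le_cross2[OF e(2) nv(1,2) nva ab(1,3)])
    have "2/3 * norm b \<le> \<bar>cross2 (- v) b\<bar>" by (rule chord_le_cross2[OF e(2) nv(3,4) nvb ab(2,4)])
    then show "2/3 * norm b \<le> \<bar>cross2 v b\<bar>" by (simp add: cross2_def abs_minus_commute)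
  qed auto
  ultimately have 1: "4/9 * (norm a * norm b) \<le> - (cross2 v a * cross2 v b)"
    by (simp add: abs_mult[symmetric])
  \<comment> \<open>the alternating sum of the four squared distances\<close>
  have "(y' - x') \<bullet> (y' - x') + v \<bullet> v - (v + a) \<bullet> (v + a) - (- v + b) \<bullet> (- v + b) = - 2 * (a \<bullet> b)"
    by (simp add: v_def a_def b_def inner_diff_left inner_diff_right inner_commute)
  moreover have "(y' - x') \<bullet> (y' - x') \<le> 1"
    using power_mono[of "norm (y' - x')" 1 2] diam by (simp add: power2_norm_eq_inner[symmetric])
  ultimately have "a \<bullet> b \<ge> - 2 * \<epsilon>"
    using norm_in_annulus_sq[OF nv(1,2) e1] norm_in_annulus_sq[OF nva e1] norm_in_annulus_sq[OF nvb e1]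
    by linarith
  moreover have "(v \<bullet> v) * (- (a \<bullet> b)) \<le> 2 * \<epsilon>"
  proof (cases "a \<bullet> b \<le> 0")
    case True
    then show ?thesis using calculation norm_in_annulus_sq[OF nv(1,2) e1]
      mult_mono[of "v \<bullet> v" 1 "- (a \<bullet> b)" "2 * \<epsilon>"] by auto
  next
    case False
    then have "(v \<bullet> v) * (a \<bullet> b) \<ge> 0" by simp
    then show ?thesis using e by simp
  qed
  \<comment> \<open>the two radial components point in opposite directions, up to \<open>\<epsilon>\<close>\<close>
  moreover have "(v \<bullet> a) * (v \<bullet> b) \<le> \<epsilon>"
  proof -
    have A: "v \<bullet> a \<le> \<epsilon>" using inner_chord_bounds[OF nv(1,2) nva e1] inner_ge_zero[of a] by linarith
    have B: "- \<epsilon> \<le> v \<bullet> b"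
      using inner_chord_bounds[OF nv(3,4) nvb e1] inner_ge_zero[of b] unfolding inner_minus_left by linarith
    have A': "- 1 \<le> v \<bullet> a" and B': "v \<bullet> b \<le> 1"
      using Cauchy_Schwarz_ineq2[of v a] Cauchy_Schwarz_ineq2[of v b] nv ab
        mult_mono[of "norm v" 1 "norm a" 1] mult_mono[of "norm v" 1 "norm b" 1]
      by (auto simp: abs_le_iff)
    show ?thesis
    proof (cases "v \<bullet> a \<ge> 0")
      case True
      then show ?thesis using mult_left_mono[OF B' True] A by simp
    next
      case False
      have "(- (v \<bullet> a)) * (- (v \<bullet> b)) \<le> (- (v \<bullet> a)) * \<epsilon>"
        using False B by (intro mult_left_mono) auto
      also have "\<dots> \<le> 1 * \<epsilon>" using A' e by (intro mult_right_mono) auto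
      finally show ?thesis by simp
    qed
  qed
  moreover have "(v \<bullet> v) * (a \<bullet> b) = (v \<bullet> a) * (v \<bullet> b) + cross2 v b * cross2 v a"
    by (rule cross2_inner_identity)
  ultimately have "4/9 * (norm a * norm b) \<le> 3 * \<epsilon>" using 1 by (simp add: mult.commute)
  moreover have "0 \<le> norm a * norm b" by simp
  ultimately show ?thesis unfolding a_def[symmetric] b_def[symmetric]
    using e by (simp add: mult.commute)
qed

section \<open>Packing in a thin annulus\<close>

lemma card_floor_image_le:
  fixes g h :: "'a \<Rightarrow> real"
  assumes "\<And>x. x \<in> S \<Longrightarrow> \<bar>g x\<bar> \<le> M" "\<And>x. x \<in> S \<Longrightarrow> \<bar>h x\<bar> \<le> L" "0 \<le> M" "0 \<le> L"
  shows "real (card ((\<lambda>x. (\<lfloor>g x\<rfloor>, \<lfloor>h x\<rfloor>)) ` S)) \<le> (2 * M + 2) * (2 * L + 2)"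
proof -
  have *: "real (card {\<lfloor>- K\<rfloor>..\<lfloor>K\<rfloor>}) \<le> 2 * K + 2" if "0 \<le> K" for K :: real
    using that by (simp, linarith)
  have "card ((\<lambda>x. (\<lfloor>g x\<rfloor>, \<lfloor>h x\<rfloor>)) ` S) \<le> card ({\<lfloor>- M\<rfloor>..\<lfloor>M\<rfloor>} \<times> {\<lfloor>- L\<rfloor>..\<lfloor>L\<rfloor>})"
    using assms by (intro card_mono) (auto intro!: floor_mono simp: abs_le_iff minus_le_iff)
  then have "real (card ((\<lambda>x. (\<lfloor>g x\<rfloor>, \<lfloor>h x\<rfloor>)) ` S)) \<le> real (card {\<lfloor>- M\<rfloor>..\<lfloor>M\<rfloor>}) * real (card {\<lfloor>- L\<rfloor>..\<lfloor>L\<rfloor>})"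
    by (simp only: card_cartesian_product flip: of_nat_mult)
  also have "\<dots> \<le> (2 * M + 2) * (2 * L + 2)"
    using *[OF assms(3)] *[OF assms(4)] by (intro mult_mono) auto
  finally show ?thesis .
qed

lemma abs_diff_less_of_floor_eq:
  fixes s t :: real
  assumes "\<lfloor>s / \<eta>\<rfloor> = \<lfloor>t / \<eta>\<rfloor>" "0 < \<eta>"
  shows "\<bar>s - t\<bar> < \<eta>"
proof -
  have "\<bar>s / \<eta> - t / \<eta>\<bar> < 1" using assms(1) by linarith
  then have "\<bar>(s - t) / \<eta>\<bar> < 1" by (simp add: diff_divide_distrib)
  then show ?thesis using assms(2) by (simp add: abs_divide)
qed

text \<open>A thin annulus is essentially one-dimensional: a separated subset of it has at most linearly many
  points in the distance. The points are sorted into bins of side \<open>\<eta>\<close> by the tangential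
  coordinate \<open>cross2 v (z - y)\<close> and the squared radius, which varies only by \<open>2 \<epsilon>\<close>. These coordinates
  are transversal because the directions of all points of \<open>S\<close> from \<open>x\<close> differ by at most little more than
  \<open>60\<close> degrees from that of \<open>y\<close>; so two points in one bin are at distance at most \<open>8 \<eta>\<close>.\<close>

lemma card_arc_le:
  fixes S :: "(real^2) set" and x y :: "real^2"
  assumes e: "0 < \<epsilon>" "\<epsilon> \<le> 1/10" and d: "0 \<le> \<delta>"
    and y: "1 - \<epsilon> \<le> norm (y - x)" "norm (y - x) \<le> 1"
    and S: "\<And>z. z \<in> S \<Longrightarrow> 1 - \<epsilon> \<le> norm (z - x) \<and> norm (z - x) \<le> 1 \<and> norm (z - y) \<le> 1 \<and> norm (z - y) \<le> \<delta>"
    and sep: "\<And>z z'. z \<in> S \<Longrightarrow> z' \<in> S \<Longrightarrow> z \<noteq> z' \<Longrightarrow> \<epsilon> / 4 < norm (z - z')"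
  shows "real (card S) \<le> 8320 * (1 + \<delta> / \<epsilon>)"
proof -
  define v where "v = y - x"
  define \<eta> where "\<eta> = \<epsilon> / 32"
  have \<eta>: "0 < \<eta>" using e by (simp add: \<eta>_def)
  have e1: "\<epsilon> \<le> 1" using e by simp
  define g where "g z = cross2 v (z - y) / \<eta>" for z
  define h where "h z = ((z - x) \<bullet> (z - x) - 1) / \<eta>" for z
  have nv: "1 - \<epsilon> \<le> norm v" "norm v \<le> 1" using y by (simp_all add: v_def)
  have inj: "inj_on (\<lambda>z. (\<lfloor>g z\<rfloor>, \<lfloor>h z\<rfloor>)) S"
  proof (rule inj_onI, rule ccontr)
    fix z z' assume z: "z \<in> S" "z' \<in> S" and eq: "(\<lfloor>g z\<rfloor>, \<lfloor>h z\<rfloor>) = (\<lfloor>g z'\<rfloor>, \<lfloor>h z'\<rfloor>)" and ne: "z \<noteq> z'"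
    define D where "D = z - z'"
    define w where "w = (z - x) + (z' - x)"
    have "\<bar>cross2 v (z - y) - cross2 v (z' - y)\<bar> < \<eta>"
      using eq abs_diff_less_of_floor_eq[OF _ \<eta>] unfolding g_def by blast
    then have 1: "\<bar>cross2 v D\<bar> < \<eta>"
      by (simp add: D_def flip: cross2_diff_right)
    have "\<bar>((z - x) \<bullet> (z - x) - 1) - ((z' - x) \<bullet> (z' - x) - 1)\<bar> < \<eta>"
      using eq abs_diff_less_of_floor_eq[OF _ \<eta>] unfolding h_def by blast
    moreover have "((z - x) \<bullet> (z - x) - 1) - ((z' - x) \<bullet> (z' - x) - 1) = w \<bullet> D"
    proof -
      have "p \<bullet> p - 1 - (q \<bullet> q - 1) = (p + q) \<bullet> (p - q)" for p q :: "real^2"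
        unfolding inner_diff_right inner_add_left by (simp add: inner_commute)
      from this[of "z - x" "z' - x"] show ?thesis by (simp add: D_def w_def)
    qed
    ultimately have 2: "\<bar>w \<bullet> D\<bar> < \<eta>" by simp
    have nw: "norm w \<le> 2" unfolding w_def
      using norm_triangle_ineq[of "z - x" "z' - x"] S[OF z(1)] S[OF z(2)] by linarith
    \<comment> \<open>the squared radius has differential \<open>w\<close>, and \<open>w\<close> is not close to being perpendicular to \<open>v\<close>\<close>
    have chord: "- 1/2 - 1/10 \<le> v \<bullet> (u - y)" if "u \<in> S" for u
    proof -
      have "v + (u - y) = u - x" by (simp add: v_def)
      then have "- ((u - y) \<bullet> (u - y)) / 2 - \<epsilon> \<le> v \<bullet> (u - y)"
        using S[OF that] by (intro inner_chord_bounds(1)[OF nv _ _ e1]) (simp_all only:)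
      moreover have "(u - y) \<bullet> (u - y) \<le> 1"
        using power_mono[of "norm (u - y)" 1 2] S[OF that] by (simp add: power2_norm_eq_inner[symmetric])
      ultimately show ?thesis using e by linarith
    qed
    have "((v + p) + (v + q)) \<bullet> v = 2 * (v \<bullet> v) + v \<bullet> p + v \<bullet> q" for p q
      unfolding inner_add_left by (simp add: inner_commute)
    from this[of "z - y" "z' - y"]
    have "w \<bullet> v = 2 * (v \<bullet> v) + v \<bullet> (z - y) + v \<bullet> (z' - y)"
      by (simp add: w_def v_def)
    moreover have "1 - 2 * \<epsilon> \<le> v \<bullet> v" by (rule norm_in_annulus_sq(1)[OF nv e1])
    ultimately have wv: "4/10 \<le> w \<bullet> v"
      using chord[OF z(1)] chord[OF z(2)] e by linarith
    have "(w \<bullet> v) * (D \<bullet> D) = (w \<bullet> D) * (v \<bullet> D) + cross2 w D * cross2 v D"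
      by (rule cross2_inner_identity)
    also have "\<dots> \<le> \<bar>w \<bullet> D\<bar> * \<bar>v \<bullet> D\<bar> + \<bar>cross2 w D\<bar> * \<bar>cross2 v D\<bar>"
      unfolding abs_mult[symmetric] by linarith
    also have "\<dots> \<le> \<eta> * (norm v * norm D) + (norm w * norm D) * \<eta>"
      using 1 2 \<eta> Cauchy_Schwarz_ineq2[of v D] abs_cross2_le[of w D]
      by (intro add_mono mult_mono) auto
    also have "\<dots> \<le> \<eta> * (1 * norm D) + (2 * norm D) * \<eta>"
      using nv nw \<eta> by (intro add_mono mult_mono) auto
    finally have "(w \<bullet> v) * (D \<bullet> D) \<le> 3 * \<eta> * norm D" by simp
    moreover have "4/10 * (D \<bullet> D) \<le> (w \<bullet> v) * (D \<bullet> D)"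
      using wv by (intro mult_right_mono) auto
    ultimately have "(4/10 * norm D) * norm D \<le> (3 * \<eta>) * norm D"
      by (simp add: dot_square_norm power2_eq_square)
    then have "norm D \<le> 8 * \<eta>" using ne \<eta> by (simp add: D_def)
    then show False using sep[OF z ne] by (simp add: D_def \<eta>_def)
  qed
  have "real (card S) = real (card ((\<lambda>z. (\<lfloor>g z\<rfloor>, \<lfloor>h z\<rfloor>)) ` S))"
    using card_image[OF inj] by simp
  also have "\<dots> \<le> (2 * (32 * \<delta> / \<epsilon>) + 2) * (2 * 64 + 2)"
  proof (rule card_floor_image_le)
    fix z assume z: "z \<in> S"
    have "\<bar>cross2 v (z - y)\<bar> \<le> \<delta>"
      using abs_cross2_le[of v "z - y"] S[OF z] nv mult_mono[of "norm v" 1 "norm (z - y)" \<delta>] by auto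
    then show "\<bar>g z\<bar> \<le> 32 * \<delta> / \<epsilon>"
      using e by (simp add: g_def \<eta>_def field_simps)
    have "\<bar>(z - x) \<bullet> (z - x) - 1\<bar> \<le> 2 * \<epsilon>"
      using norm_in_annulus_sq[of \<epsilon> "z - x"] S[OF z] e1 by (simp add: abs_le_iff)
    then show "\<bar>h z\<bar> \<le> 64"
      using e by (simp add: h_def \<eta>_def field_simps)
  qed (use d e in auto)
  also have "\<dots> \<le> 8320 * (1 + \<delta> / \<epsilon>)" using d e by (simp add: field_simps)
  finally show ?thesis .
qed

section \<open>Ranks and the Schur test\<close>

text \<open>For injective \<open>f\<close> this is \<open>1 + 1 / \<surd>2 + \<dots> + 1 / \<surd>n \<le> 2 \<surd>n\<close>; ties only enlarge the ranks. Removing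
  the minimum, whose rank is \<open>n\<close>, does not increase any other rank.\<close>

lemma sum_inverse_sqrt_rank_le:
  fixes f :: "'a \<Rightarrow> real"
  assumes "finite S"
  shows "(\<Sum>y\<in>S. 1 / sqrt (card {z \<in> S. f y \<le> f z})) \<le> 2 * sqrt (card S)"
  using assms
proof (induction "card S" arbitrary: S)
  case 0
  then show ?case by simp
next
  case (Suc n)
  then have ne: "S \<noteq> {}" by auto
  obtain m where m: "m \<in> S" "\<And>z. z \<in> S \<Longrightarrow> f m \<le> f z"
    using arg_min_if_finite[OF \<open>finite S\<close> ne] by (metis not_le)
  let ?T = "S - {m}"
  have cT: "card ?T = n" using Suc m by simp
  have "{z \<in> S. f m \<le> f z} = S" using m by auto
  then have "(\<Sum>y\<in>S. 1 / sqrt (card {z \<in> S. f y \<le> f z}))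
      = 1 / sqrt (Suc n) + (\<Sum>y\<in>?T. 1 / sqrt (card {z \<in> S. f y \<le> f z}))"
    using Suc m by (simp add: sum.remove[of S m])
  also have "(\<Sum>y\<in>?T. 1 / sqrt (card {z \<in> S. f y \<le> f z})) \<le> (\<Sum>y\<in>?T. 1 / sqrt (card {z \<in> ?T. f y \<le> f z}))"
  proof (rule sum_mono)
    fix y assume y: "y \<in> ?T"
    have "0 < card {z \<in> ?T. f y \<le> f z}" using y Suc by (auto simp: card_gt_0_iff)
    moreover have "card {z \<in> ?T. f y \<le> f z} \<le> card {z \<in> S. f y \<le> f z}"
      using Suc by (intro card_mono) auto
    ultimately show "1 / sqrt (card {z \<in> S. f y \<le> f z}) \<le> 1 / sqrt (card {z \<in> ?T. f y \<le> f z})"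
      by (intro divide_left_mono) auto
  qed
  also have "\<dots> \<le> 2 * sqrt n"
    using Suc(1)[of ?T] cT Suc by simp
  also have "1 / sqrt (Suc n) + 2 * sqrt n \<le> 2 * sqrt (Suc n)"
  proof -
    have "2 * sqrt n * sqrt (Suc n) \<le> (sqrt n)\<^sup>2 + (sqrt (Suc n))\<^sup>2"
      using sum_squares_bound[of "sqrt n" "sqrt (Suc n)"] by simp
    then have "2 * sqrt n * sqrt (Suc n) + 1 \<le> 2 * (sqrt (Suc n) * sqrt (Suc n))"
      by simp
    then show ?thesis by (simp add: field_simps)
  qed
  finally show ?case using Suc by simp
qed

text \<open>The quadratic form of a graph is bounded by \<open>c\<close> as soon as some positive vertex function \<open>h\<close>
  satisfies \<open>M h \<le> c h\<close> for the adjacency matrix \<open>M\<close>: apply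
  \<open>2 w p w q \<le> (w p)\<^sup>2 h q / h p + (w q)\<^sup>2 h p / h q\<close> to every edge.\<close>

lemma schur_test:
  fixes w h :: "'a \<Rightarrow> real"
  assumes fin: "finite P" and sym: "\<And>p q. R p q \<Longrightarrow> R q p"
    and pos: "\<And>p q. p \<in> P \<Longrightarrow> q \<in> P \<Longrightarrow> R p q \<Longrightarrow> 0 < h p"
    and row: "\<And>p. p \<in> P \<Longrightarrow> (\<Sum>q\<in>{q \<in> P. R p q}. h q) \<le> c * h p"
    and c: "0 \<le> c"
  shows "(\<Sum>p\<in>P. \<Sum>q\<in>{q \<in> P. R p q}. w p * w q) \<le> c * (\<Sum>p\<in>P. (w p)\<^sup>2)"
proof -
  define F where "F p q = (w p)\<^sup>2 * h q / h p / 2" for p q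
  have "(\<Sum>p\<in>P. \<Sum>q\<in>{q \<in> P. R p q}. w p * w q) \<le> (\<Sum>p\<in>P. \<Sum>q\<in>{q \<in> P. R p q}. F p q + F q p)"
  proof (intro sum_mono)
    fix p q assume "p \<in> P" "q \<in> {q \<in> P. R p q}"
    then have h: "0 < h p" "0 < h q" using pos sym by blast+
    have "0 \<le> (w p * h q - w q * h p)\<^sup>2" by simp
    then show "w p * w q \<le> F p q + F q p"
      unfolding F_def using h by (simp add: field_simps power2_eq_square)
  qed
  also have "\<dots> = (\<Sum>p\<in>P. \<Sum>q\<in>{q \<in> P. R p q}. F p q) + (\<Sum>p\<in>P. \<Sum>q\<in>{q \<in> P. R p q}. F q p)"
    by (simp add: sum.distrib)
  also have "(\<Sum>p\<in>P. \<Sum>q\<in>{q \<in> P. R p q}. F q p) = (\<Sum>q\<in>P. \<Sum>p\<in>{p \<in> P. R p q}. F q p)"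
    by (rule sum.swap_restrict[OF fin fin])
  also have "\<dots> = (\<Sum>p\<in>P. \<Sum>q\<in>{q \<in> P. R p q}. F p q)"
    using sym by (intro sum.cong refl) metis+
  also have "(\<Sum>p\<in>P. \<Sum>q\<in>{q \<in> P. R p q}. F p q) \<le> (\<Sum>p\<in>P. c / 2 * (w p)\<^sup>2)"
  proof (rule sum_mono)
    fix p assume p: "p \<in> P"
    show "(\<Sum>q\<in>{q \<in> P. R p q}. F p q) \<le> c / 2 * (w p)\<^sup>2"
    proof (cases "{q \<in> P. R p q} = {}")
      case True
      then show ?thesis using c by (simp only: sum.empty) simp
    next
      case False
      then have h: "0 < h p" using pos p by blast
      have "(\<Sum>q\<in>{q \<in> P. R p q}. F p q) = (w p)\<^sup>2 / h p / 2 * (\<Sum>q\<in>{q \<in> P. R p q}. h q)"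
        by (simp add: F_def sum_distrib_left)
      also have "\<dots> \<le> (w p)\<^sup>2 / h p / 2 * (c * h p)"
        using row[OF p] h by (intro mult_left_mono) auto
      finally show ?thesis using h by (simp add: mult.commute)
    qed
  qed
  also have "\<dots> = c / 2 * (\<Sum>p\<in>P. (w p)\<^sup>2)" by (simp add: sum_distrib_left)
  finally show ?thesis by simp
qed

section \<open>The graph of almost diameters of a separated set\<close>

text \<open>The separation is smaller than the width of the annuli by a constant factor because the graph is
  used for a net of mesh \<open>\<epsilon> / 4\<close>: replacing the ends of an almost diameter by net points changes its
  length by at most \<open>\<epsilon> / 2\<close>, which the definition of an edge has to tolerate.\<close>

locale separated_unit_set =
  fixes P :: "(real^2) set" and \<epsilon> :: real
  assumes fin: "finite P"
    and eps: "0 < \<epsilon>" "\<epsilon> \<le> 1/10"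
    and diam: "\<And>p q. p \<in> P \<Longrightarrow> q \<in> P \<Longrightarrow> norm (p - q) \<le> 1"
    and sep: "\<And>p q. p \<in> P \<Longrightarrow> q \<in> P \<Longrightarrow> p \<noteq> q \<Longrightarrow> \<epsilon> / 4 < norm (p - q)"
begin

definition far :: "real^2 \<Rightarrow> (real^2) set" where
  "far x = {y \<in> P. 1 - \<epsilon> \<le> norm (y - x)}"

text \<open>The neighbors of \<open>x\<close> reached from \<open>y\<close> by turning about \<open>x\<close> counterclockwise (\<open>\<sigma> = 1\<close>) or
  clockwise (\<open>\<sigma> = -1\<close>). The point \<open>y\<close> itself is included, so that cardinalities are ranks
  counted from \<open>1\<close>.\<close>

definition side :: "real \<Rightarrow> real^2 \<Rightarrow> real^2 \<Rightarrow> (real^2) set" where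
  "side \<sigma> x y = {z \<in> far x. 0 \<le> \<sigma> * cross2 (y - x) (z - x)}"

lemma finite_far [simp]: "finite (far x)" by (simp add: far_def fin)

lemma far_sym: "x \<in> P \<Longrightarrow> y \<in> far x \<Longrightarrow> y \<in> P \<and> x \<in> far y"
  by (simp add: far_def norm_minus_commute)

lemma mem_side [simp]: "y \<in> far x \<Longrightarrow> y \<in> side \<sigma> x y"
  by (simp add: side_def)

lemma side_subset: "side \<sigma> x y \<subseteq> far x"
  by (auto simp: side_def)

lemma finite_side [simp]: "finite (side \<sigma> x y)"
  using finite_subset[OF side_subset] by simp

lemma card_side_pos: "y \<in> far x \<Longrightarrow> 0 < card (side \<sigma> x y)"
  using mem_side[of y x \<sigma>] by (auto simp: card_gt_0_iff simp del: mem_side)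

text \<open>The member of \<open>S\<close> farthest from \<open>y\<close>: packing turns a large count into a large distance.\<close>

lemma distant_member:
  assumes x: "x \<in> P" and y: "y \<in> far x" and S: "S \<subseteq> far x" "S \<noteq> {}"
  obtains z where "z \<in> S" "real (card S) \<le> 8320 * (1 + norm (z - y) / \<epsilon>)"
proof -
  have "finite S" using finite_subset[OF S(1)] by simp
  then obtain z where z: "z \<in> S" "\<And>u. u \<in> S \<Longrightarrow> norm (u - y) \<le> norm (z - y)"
    using arg_min_if_finite[of S "\<lambda>u. - norm (u - y)"] S by (metis neg_less_iff_less not_le)
  have "real (card S) \<le> 8320 * (1 + norm (z - y) / \<epsilon>)"
  proof (rule card_arc_le[OF eps, of _ y x])
    show "1 - \<epsilon> \<le> norm (y - x)" "norm (y - x) \<le> 1"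
      using x y diam by (auto simp: far_def)
    show "1 - \<epsilon> \<le> norm (u - x) \<and> norm (u - x) \<le> 1 \<and> norm (u - y) \<le> 1 \<and> norm (u - y) \<le> norm (z - y)"
      if "u \<in> S" for u
      using that x y S z diam by (auto simp: far_def)
    show "\<epsilon> / 4 < norm (u - u')" if "u \<in> S" "u' \<in> S" "u \<noteq> u'" for u u'
      using that S sep by (auto simp: far_def)
  qed auto
  with z show ?thesis using that by blast
qed

text \<open>Fix an almost diameter \<open>x y\<close>. If many neighbors of \<open>x\<close> lie on one side of \<open>y\<close>, then
  by packing one of them is far from \<open>y\<close>, and similarly with \<open>x\<close> and \<open>y\<close> exchanged. By
  \<open>opposite_chords\<close> both cannot happen: the product of the two distances is \<open>O(\<epsilon>)\<close>, while a
  count of \<open>k\<close> points forces a distance of order \<open>k \<epsilon>\<close>. The numeral is \<open>13 \<cdot> 8320\<^sup>2\<close>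
  rounded up to a square.\<close>

lemma card_side_mult_le:
  assumes x: "x \<in> P" and y: "y \<in> far x" and "\<sigma> \<noteq> 0"
  shows "real (card (side \<sigma> x y)) * real (card (side \<sigma> y x)) \<le> 30000\<^sup>2 / \<epsilon>"
proof -
  have yP: "y \<in> P" and xy: "x \<in> far y" using far_sym[OF x y] by auto
  obtain y' where y': "y' \<in> side \<sigma> x y" "real (card (side \<sigma> x y)) \<le> 8320 * (1 + norm (y' - y) / \<epsilon>)"
    using distant_member[OF x y side_subset] mem_side[OF y] by (metis empty_iff)
  obtain x' where x': "x' \<in> side \<sigma> y x" "real (card (side \<sigma> y x)) \<le> 8320 * (1 + norm (x' - x) / \<epsilon>)"
    using distant_member[OF yP xy side_subset] mem_side[OF xy] by (metis empty_iff)
  have P': "y' \<in> P" "x' \<in> P" using x' y' by (auto simp: side_def far_def)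
  have "0 \<le> (\<sigma> * cross2 (y - x) (y' - x)) * (\<sigma> * cross2 (x - y) (x' - y))"
    using x' y' by (simp add: side_def)
  then have "0 \<le> \<sigma>\<^sup>2 * (cross2 (y - x) (y' - x) * cross2 (x - y) (x' - y))"
    by (simp add: power2_eq_square mult_ac)
  then have side: "0 \<le> cross2 (y - x) (y' - x) * cross2 (x - y) (x' - y)"
    using \<open>\<sigma> \<noteq> 0\<close> by (simp add: zero_le_mult_iff)
  have prod: "norm (x' - x) * norm (y' - y) \<le> 10 * \<epsilon>"
    using opposite_chords[OF eps _ _ _ _ _ _ _ _ _ side] diam x yP P' y x' y'
    by (auto simp: side_def far_def)
  define \<alpha> \<beta> where "\<alpha> = norm (y' - y) / \<epsilon>" and "\<beta> = norm (x' - x) / \<epsilon>"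
  have a: "0 \<le> \<alpha>" "\<alpha> \<le> 1 / \<epsilon>" "0 \<le> \<beta>" "\<beta> \<le> 1 / \<epsilon>"
    using eps diam x yP P' by (auto simp: \<alpha>_def \<beta>_def divide_right_mono)
  have "\<alpha> * \<beta> \<le> 10 / \<epsilon>"
    using prod eps by (simp add: \<alpha>_def \<beta>_def field_simps)
  moreover have "1 \<le> 1 / \<epsilon>" using eps by simp
  ultimately have "(1 + \<alpha>) * (1 + \<beta>) \<le> 13 * (1 / \<epsilon>)"
    using a by (simp add: algebra_simps)
  then have bound: "8320\<^sup>2 * ((1 + \<alpha>) * (1 + \<beta>)) \<le> 8320\<^sup>2 * (13 * (1 / \<epsilon>))"
    by (rule mult_left_mono) simp
  have "real (card (side \<sigma> x y)) * real (card (side \<sigma> y x)) \<le> (8320 * (1 + \<alpha>)) * (8320 * (1 + \<beta>))"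
    using x' y' a by (intro mult_mono) (auto simp: \<alpha>_def \<beta>_def)
  also have "\<dots> = 8320\<^sup>2 * ((1 + \<alpha>) * (1 + \<beta>))"
    by (simp only: power2_eq_square mult_ac)
  also have "\<dots> \<le> 8320\<^sup>2 * (13 * (1 / \<epsilon>))" by (rule bound)
  also have "\<dots> \<le> 30000\<^sup>2 / \<epsilon>" using eps by (simp add: divide_right_mono)
  finally show ?thesis .
qed

text \<open>The neighbors of \<open>x\<close> lie in a half-plane bounded by a line through \<open>x\<close>, so turning about \<open>x\<close> orders
  them linearly; the tangent of the angle with one fixed neighbor is a key for this order.\<close>

lemma angular_key_exists:
  assumes x: "x \<in> P"
  obtains f :: "real^2 \<Rightarrow> real"
  where "\<And>y z. y \<in> far x \<Longrightarrow> z \<in> far x \<Longrightarrow> 0 \<le> cross2 (y - x) (z - x) \<longleftrightarrow> f y \<le> f z"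
proof (cases "far x = {}")
  case True
  then show ?thesis using that by simp
next
  case False
  then obtain y0 where y0: "y0 \<in> far x" by auto
  define u where "u = y0 - x"
  have u: "1 - \<epsilon> \<le> norm u" "norm u \<le> 1" using x y0 diam by (auto simp: u_def far_def)
  have uu: "0 < u \<bullet> u" using norm_in_annulus_sq(1)[OF u] eps by linarith
  have pos: "0 < u \<bullet> (y - x)" if y: "y \<in> far x" for y
  proof -
    have "u + (y - y0) = y - x" by (simp add: u_def)
    moreover have "1 - \<epsilon> \<le> norm (y - x)" "norm (y - x) \<le> 1" using x y diam by (auto simp: far_def)
    ultimately have "- ((y - y0) \<bullet> (y - y0)) / 2 - \<epsilon> \<le> u \<bullet> (y - y0)"
      using eps by (intro inner_chord_bounds(1)[OF u]) (simp_all only:)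
    moreover have "norm (y - y0) \<le> 1" using y y0 diam by (auto simp: far_def)
    then have "(y - y0) \<bullet> (y - y0) \<le> 1"
      using power_mono[of "norm (y - y0)" 1 2] by (simp add: power2_norm_eq_inner[symmetric])
    moreover have "1 - 2 * \<epsilon> \<le> u \<bullet> u" using norm_in_annulus_sq[OF u] eps by simp
    moreover have "u \<bullet> (y - x) = u \<bullet> u + u \<bullet> (y - y0)" by (simp add: u_def inner_diff_right)
    ultimately show ?thesis using eps by linarith
  qed
  show ?thesis
  proof (rule that[of "\<lambda>y. cross2 u (y - x) / (u \<bullet> (y - x))"])
    fix y z assume yz: "y \<in> far x" "z \<in> far x"
    have "0 \<le> cross2 (y - x) (z - x) \<longleftrightarrow> 0 \<le> (u \<bullet> u) * cross2 (y - x) (z - x)"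
      using mult_le_cancel_left_pos[OF uu, of 0] by simp
    also have "\<dots> \<longleftrightarrow> (u \<bullet> (z - x)) * cross2 u (y - x) \<le> (u \<bullet> (y - x)) * cross2 u (z - x)"
      unfolding cross2_exchange by simp
    finally show "0 \<le> cross2 (y - x) (z - x) \<longleftrightarrow>
        cross2 u (y - x) / (u \<bullet> (y - x)) \<le> cross2 u (z - x) / (u \<bullet> (z - x))"
      using pos[OF yz(1)] pos[OF yz(2)] by (simp add: field_simps)
  qed
qed

text \<open>Seen from \<open>x\<close>, the number of neighbors on one side of \<open>y\<close> is the rank of \<open>y\<close> in the angular order.\<close>

lemma sum_inverse_sqrt_side_le:
  assumes x: "x \<in> P" and \<sigma>: "\<sigma> = 1 \<or> \<sigma> = -1"
  shows "(\<Sum>y\<in>far x. 1 / sqrt (card (side \<sigma> x y))) \<le> 2 * sqrt (card (far x))"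
proof -
  obtain f :: "real^2 \<Rightarrow> real" where f: "\<And>y z. y \<in> far x \<Longrightarrow> z \<in> far x \<Longrightarrow> 0 \<le> cross2 (y - x) (z - x) \<longleftrightarrow> f y \<le> f z"
    using angular_key_exists[OF x] by blast
  have anti: "0 \<le> - cross2 (y - x) (z - x) \<longleftrightarrow> f z \<le> f y" if "y \<in> far x" "z \<in> far x" for y z
    using f[OF that(2,1)] by (simp add: cross2_def algebra_simps)
  have "side \<sigma> x y = {z \<in> far x. \<sigma> * f y \<le> \<sigma> * f z}" if y: "y \<in> far x" for y
    unfolding side_def using \<sigma> f[OF y] anti[OF y] by auto
  then have "(\<Sum>y\<in>far x. 1 / sqrt (card (side \<sigma> x y)))
      = (\<Sum>y\<in>far x. 1 / sqrt (card {z \<in> far x. \<sigma> * f y \<le> \<sigma> * f z}))"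
    by (intro sum.cong) auto
  then show ?thesis using sum_inverse_sqrt_rank_le[of "far x" "\<lambda>y. \<sigma> * f y"] by simp
qed

text \<open>This is the inequality \<open>M h \<le> c h\<close> for the Schur test with \<open>h\<close> the square root of the degree, and
  \<open>c\<close> of order \<open>1 / \<surd>\<epsilon>\<close>. The neighbors of \<open>y\<close> are split by the line \<open>x y\<close> into two sides. On each
  side \<open>card_side_mult_le\<close> bounds their number by \<open>O(1 / (\<epsilon> k))\<close>, where \<open>k\<close> is the rank of \<open>y\<close> among
  the neighbors of \<open>x\<close> from that side. Summing \<open>1 / \<surd>(\<epsilon> k)\<close> over the ranks gives \<open>\<surd>(card (far x) / \<epsilon>)\<close>.
  Uniform weights would not do: a Reuleaux triangle has vertices of degree about \<open>1 / \<epsilon>\<close>.\<close>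

lemma sum_sqrt_degree_le:
  assumes x: "x \<in> P"
  shows "(\<Sum>y\<in>far x. sqrt (card (far y))) \<le> 4 * sqrt (30000\<^sup>2 / \<epsilon>) * sqrt (card (far x))"
proof -
  let ?K = "30000\<^sup>2 / \<epsilon>"
  have "sqrt (card (far y)) \<le> sqrt ?K * (1 / sqrt (card (side 1 x y))) + sqrt ?K * (1 / sqrt (card (side (-1) x y)))"
    if y: "y \<in> far x" for y
  proof -
    have one: "sqrt (card (side \<sigma> y x)) \<le> sqrt ?K * (1 / sqrt (card (side \<sigma> x y)))" if "\<sigma> \<noteq> 0" for \<sigma>
    proof -
      have "sqrt (card (side \<sigma> x y)) * sqrt (card (side \<sigma> y x)) \<le> sqrt ?K"
        unfolding real_sqrt_mult[symmetric] using card_side_mult_le[OF x y that] by (rule real_sqrt_le_mono)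
      then show ?thesis using card_side_pos[OF y, of \<sigma>] by (simp add: pos_le_divide_eq mult.commute)
    qed
    have "far y = side 1 y x \<union> side (-1) y x" by (auto simp: side_def)
    then have "card (far y) \<le> card (side 1 y x) + card (side (-1) y x)"
      by (simp add: card_Un_le)
    then have "sqrt (card (far y)) \<le> sqrt (real (card (side 1 y x)) + real (card (side (-1) y x)))"
      by simp
    also have "\<dots> \<le> sqrt (card (side 1 y x)) + sqrt (card (side (-1) y x))"
      by (rule sqrt_add_le_add_sqrt) auto
    finally show ?thesis using one[of 1] one[of "-1"] by linarith
  qed
  then have "(\<Sum>y\<in>far x. sqrt (card (far y))) \<le>
     (\<Sum>y\<in>far x. sqrt ?K * (1 / sqrt (card (side 1 x y))) + sqrt ?K * (1 / sqrt (card (side (-1) x y))))"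
    by (rule sum_mono)
  also have "\<dots> = sqrt ?K * (\<Sum>y\<in>far x. 1 / sqrt (card (side 1 x y)))
      + sqrt ?K * (\<Sum>y\<in>far x. 1 / sqrt (card (side (-1) x y)))"
    by (simp only: sum.distrib sum_distrib_left)
  also have "\<dots> \<le> sqrt ?K * (2 * sqrt (card (far x))) + sqrt ?K * (2 * sqrt (card (far x)))"
    using sum_inverse_sqrt_side_le[OF x, of 1] sum_inverse_sqrt_side_le[OF x, of "-1"] eps
    by (intro add_mono mult_left_mono) auto
  also have "\<dots> = 4 * sqrt ?K * sqrt (card (far x))" by algebra
  finally show ?thesis .
qed

lemma far_form_le:
  fixes w :: "real^2 \<Rightarrow> real"
  shows "(\<Sum>p\<in>P. \<Sum>q\<in>far p. w p * w q) \<le> 120000 / sqrt \<epsilon> * (\<Sum>p\<in>P. (w p)\<^sup>2)"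
proof -
  have const: "4 * sqrt (30000\<^sup>2 / \<epsilon>) = 120000 / sqrt \<epsilon>"
    by (simp only: real_sqrt_divide real_sqrt_abs)
  have far: "far p = {q \<in> P. 1 - \<epsilon> \<le> norm (q - p)}" for p by (simp add: far_def)
  have "(\<Sum>p\<in>P. \<Sum>q\<in>{q \<in> P. 1 - \<epsilon> \<le> norm (q - p)}. w p * w q) \<le> 120000 / sqrt \<epsilon> * (\<Sum>p\<in>P. (w p)\<^sup>2)"
  proof (rule schur_test[where h = "\<lambda>p. sqrt (card (far p))"])
    fix p q assume "p \<in> P" "q \<in> P" "1 - \<epsilon> \<le> norm (q - p)"
    then have "q \<in> far p" by (simp add: far_def)
    then show "0 < sqrt (card (far p))" by (auto simp: card_gt_0_iff)
  next
    fix p assume p: "p \<in> P"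
    show "(\<Sum>q\<in>{q \<in> P. 1 - \<epsilon> \<le> norm (q - p)}. sqrt (card (far q))) \<le> 120000 / sqrt \<epsilon> * sqrt (card (far p))"
      using sum_sqrt_degree_le[OF p] unfolding far[symmetric] const .
  qed (use fin eps in \<open>auto simp: norm_minus_commute\<close>)
  then show ?thesis unfolding far .
qed

end

section \<open>Close pairs by the pigeonhole principle\<close>

text \<open>The pairs counted here are ordered, and those on the diagonal are included: this makes the number
  of close pairs in a cluster comparable with the square of its size, even for a single point.\<close>

definition close_pairs :: "real \<Rightarrow> (real^2) set \<Rightarrow> ((real^2) \<times> (real^2)) set" where
  "close_pairs \<eta> S = {(x, y). x \<in> S \<and> y \<in> S \<and> norm (x - y) \<le> \<eta>}"

lemma finite_close_pairs [simp]: "finite S \<Longrightarrow> finite (close_pairs \<eta> S)"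
  by (rule finite_subset[of _ "S \<times> S"]) (auto simp: close_pairs_def)

lemma sum_sq_card_fibres:
  assumes "finite S"
  shows "(\<Sum>c\<in>g ` S. (real (card {x \<in> S. g x = c}))\<^sup>2) = card {(x, y). x \<in> S \<and> y \<in> S \<and> g x = g y}"
proof -
  have "{(x, y). x \<in> S \<and> y \<in> S \<and> g x = g y} = (\<Union>c\<in>g ` S. {x \<in> S. g x = c} \<times> {x \<in> S. g x = c})"
    by auto
  also have "card \<dots> = (\<Sum>c\<in>g ` S. card ({x \<in> S. g x = c} \<times> {x \<in> S. g x = c}))"
    using assms by (intro card_UN_disjoint) auto
  finally show ?thesis by (simp add: card_cartesian_product power2_eq_square)
qed

lemma card_sq_le_pairs_in_fibres:
  assumes "finite S"
  shows "(real (card S))\<^sup>2 \<le> card (g ` S) * real (card {(x, y). x \<in> S \<and> y \<in> S \<and> g x = g y})"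
proof -
  have "real (card S) = (\<Sum>c\<in>g ` S. real (card {x \<in> S. g x = c}))"
  proof -
    have "card S = card (\<Union>c\<in>g ` S. {x \<in> S. g x = c})" by (rule arg_cong[where f = card]) auto
    also have "\<dots> = (\<Sum>c\<in>g ` S. card {x \<in> S. g x = c})"
      using assms by (intro card_UN_disjoint) auto
    finally show ?thesis by simp
  qed
  then have "(real (card S))\<^sup>2 \<le> (\<Sum>c\<in>g ` S. (real (card {x \<in> S. g x = c}))\<^sup>2) * card (g ` S)"
    using sum_squared_le_sum_of_squares[of "\<lambda>c. real (card {x \<in> S. g x = c})" "g ` S"] assms
    by (simp add: mult.commute)
  then show ?thesis unfolding sum_sq_card_fibres[OF assms] by (simp add: mult.commute)
qed

text \<open>In a grid of mesh \<open>\<eta> / 2\<close> the points of one cell are at distance at most \<open>\<eta>\<close>, and \<open>S\<close> meets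
  \<open>O((1 + D / \<eta>)\<^sup>2)\<close> cells.\<close>

lemma card_sq_le_close_pairs:
  fixes S :: "(real^2) set"
  assumes S: "finite S" and \<eta>: "0 < \<eta>" and D: "\<And>x y. x \<in> S \<Longrightarrow> y \<in> S \<Longrightarrow> norm (x - y) \<le> D"
  shows "(real (card S))\<^sup>2 \<le> 16 * (1 + D / \<eta>)\<^sup>2 * card (close_pairs \<eta> S)"
proof (cases "S = {}")
  case True
  then show ?thesis by simp
next
  case False
  then obtain c where c: "c \<in> S" by auto
  then have D0: "0 \<le> D" using D[of c c] by simp
  define k where "k i x = (x - c)$i / (\<eta> / 2)" for i :: 2 and x
  let ?g = "\<lambda>x. (\<lfloor>k 1 x\<rfloor>, \<lfloor>k 2 x\<rfloor>)"
  have k: "\<bar>k i x\<bar> \<le> 2 * D / \<eta>" if "x \<in> S" for i x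
  proof -
    have "\<bar>(x - c)$i\<bar> \<le> D" using component_le_norm_cart[of "x - c" i] D[OF that c] by linarith
    then have "\<bar>(x - c)$i\<bar> / (\<eta> / 2) \<le> D / (\<eta> / 2)" using \<eta> by (intro divide_right_mono) auto
    moreover have "\<bar>k i x\<bar> = \<bar>(x - c)$i\<bar> / (\<eta> / 2)"
      using \<eta> unfolding k_def abs_divide by simp
    ultimately show ?thesis by (simp add: mult.commute)
  qed
  have "real (card (?g ` S)) \<le> (2 * (2 * D / \<eta>) + 2) * (2 * (2 * D / \<eta>) + 2)"
    using k D0 \<eta> by (intro card_floor_image_le) auto
  also have "\<dots> \<le> (4 * (1 + D / \<eta>)) * (4 * (1 + D / \<eta>))"
    using D0 \<eta> by (intro mult_mono) auto
  also have "\<dots> = 16 * (1 + D / \<eta>)\<^sup>2" by (simp only: power2_eq_square mult_ac) simp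
  finally have 1: "real (card (?g ` S)) \<le> 16 * (1 + D / \<eta>)\<^sup>2" .
  have "{(x, y). x \<in> S \<and> y \<in> S \<and> ?g x = ?g y} \<subseteq> close_pairs \<eta> S"
  proof (clarsimp simp: close_pairs_def)
    fix x y assume "\<lfloor>k 1 x\<rfloor> = \<lfloor>k 1 y\<rfloor>" "\<lfloor>k 2 x\<rfloor> = \<lfloor>k 2 y\<rfloor>"
    then have "\<bar>(x - c)$1 - (y - c)$1\<bar> < \<eta> / 2" "\<bar>(x - c)$2 - (y - c)$2\<bar> < \<eta> / 2"
      unfolding k_def using \<eta> by (blast intro: abs_diff_less_of_floor_eq half_gt_zero)+
    moreover have "norm (x - y) \<le> \<bar>(x - y)$1\<bar> + \<bar>(x - y)$2\<bar>"
      using norm_le_l1_cart[of "x - y"] by (simp add: sum_2)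
    ultimately show "norm (x - y) \<le> \<eta>" by simp
  qed
  then have 2: "card {(x, y). x \<in> S \<and> y \<in> S \<and> ?g x = ?g y} \<le> card (close_pairs \<eta> S)"
    using S by (intro card_mono) auto
  have "(real (card S))\<^sup>2 \<le> card (?g ` S) * real (card {(x, y). x \<in> S \<and> y \<in> S \<and> ?g x = ?g y})"
    by (rule card_sq_le_pairs_in_fibres[OF S])
  also have "\<dots> \<le> 16 * (1 + D / \<eta>)\<^sup>2 * card (close_pairs \<eta> S)"
    using 1 2 by (intro mult_mono) auto
  finally show ?thesis .
qed

section \<open>From far pairs to close pairs\<close>

lemma net_exists:
  fixes X :: "'a::real_normed_vector set"
  assumes "finite X" "0 \<le> r"
  obtains P where "P \<subseteq> X" "\<And>p q. p \<in> P \<Longrightarrow> q \<in> P \<Longrightarrow> p \<noteq> q \<Longrightarrow> r < norm (p - q)"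
    "\<And>x. x \<in> X \<Longrightarrow> \<exists>p\<in>P. norm (x - p) \<le> r"
proof -
  let ?A = "{P. P \<subseteq> X \<and> (\<forall>p\<in>P. \<forall>q\<in>P. p \<noteq> q \<longrightarrow> r < norm (p - q))}"
  have "finite ?A" using assms by (intro finite_subset[of ?A "Pow X"]) auto
  moreover have "{} \<in> ?A" by simp
  ultimately have "\<exists>P\<in>?A. \<forall>Q\<in>?A. P \<subseteq> Q \<longrightarrow> P = Q"
    by (intro finite_has_maximal) auto
  then obtain P where P: "P \<in> ?A" and max: "\<And>Q. Q \<in> ?A \<Longrightarrow> P \<subseteq> Q \<Longrightarrow> P = Q"
    by auto
  have "\<exists>p\<in>P. norm (x - p) \<le> r" if x: "x \<in> X" for x
  proof (rule ccontr)
    assume "\<not> ?thesis"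
    then have far: "\<forall>p\<in>P. r < norm (x - p) \<and> r < norm (p - x)" by (auto simp: norm_minus_commute)
    then have "insert x P \<in> ?A" using P x by auto
    then have "x \<in> P" using max by blast
    then show False using far assms by auto
  qed
  then show ?thesis using P that by auto
qed

definition far_pairs :: "real \<Rightarrow> (real^2) set \<Rightarrow> ((real^2) \<times> (real^2)) set" where
  "far_pairs \<epsilon> X = {(x, y). x \<in> X \<and> y \<in> X \<and> 1 - \<epsilon> \<le> norm (x - y)}"

lemma finite_far_pairs [simp]: "finite X \<Longrightarrow> finite (far_pairs \<epsilon> X)"
  by (rule finite_subset[of _ "X \<times> X"]) (auto simp: far_pairs_def)

lemma sum_card_close_pairs_fibres_le:
  assumes "finite X" "finite P"
  shows "(\<Sum>p\<in>P. card (close_pairs \<eta> {x \<in> X. g x = p})) \<le> card (close_pairs \<eta> X)"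
proof -
  have "(\<Sum>p\<in>P. card (close_pairs \<eta> {x \<in> X. g x = p})) = card (\<Union>p\<in>P. close_pairs \<eta> {x \<in> X. g x = p})"
    using assms by (intro card_UN_disjoint[symmetric] ballI impI finite_close_pairs)
      (auto simp: close_pairs_def)
  also have "\<dots> \<le> card (close_pairs \<eta> X)"
    using assms by (intro card_mono finite_close_pairs) (auto simp: close_pairs_def)
  finally show ?thesis .
qed

lemma sq_over_sqrt: "0 < \<epsilon> \<Longrightarrow> \<epsilon>\<^sup>2 / sqrt \<epsilon> = \<epsilon> powr (3/2)" for \<epsilon> :: real
  using powr_diff[of \<epsilon> 2 "1/2"] by (simp add: powr_half_sqrt)

text \<open>The points of \<open>X\<close> are grouped around a net of mesh \<open>\<epsilon> / 2\<close>. A far pair of \<open>X\<close> lies over an edge of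
  the graph of almost diameters of the net with \<open>2 \<epsilon>\<close> in place of \<open>\<epsilon>\<close>, so \<open>far_form_le\<close> bounds the number
  of far pairs by \<open>O(1 / \<surd>\<epsilon>)\<close> times the sum of the squared cluster sizes. A cluster has diameter at
  most \<open>\<epsilon>\<close>, so its squared size is \<open>O((\<epsilon> / \<eta>)\<^sup>2)\<close> times its number of close pairs.\<close>

lemma card_far_pairs_le_small:
  assumes X: "finite X" and diam: "\<And>x y. x \<in> X \<Longrightarrow> y \<in> X \<Longrightarrow> norm (x - y) \<le> 1"
    and \<eta>: "0 < \<eta>" "\<eta> \<le> \<epsilon>" and \<epsilon>: "\<epsilon> \<le> 1/20"
  shows "real (card (far_pairs \<epsilon> X)) \<le> 7680000 * \<epsilon> powr (3/2) / \<eta>\<^sup>2 * card (close_pairs \<eta> X)"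
proof -
  have \<epsilon>0: "0 < \<epsilon>" using \<eta> by simp
  obtain P where PX: "P \<subseteq> X" and sep: "\<And>p q. p \<in> P \<Longrightarrow> q \<in> P \<Longrightarrow> p \<noteq> q \<Longrightarrow> \<epsilon> / 2 < norm (p - q)"
    and near: "\<And>x. x \<in> X \<Longrightarrow> \<exists>p\<in>P. norm (x - p) \<le> \<epsilon> / 2"
    using net_exists[OF X, of "\<epsilon> / 2"] \<epsilon>0 by auto
  interpret separated_unit_set P "2 * \<epsilon>"
  proof
    show "finite P" using PX X by (rule finite_subset)
    show "norm (p - q) \<le> 1" if "p \<in> P" "q \<in> P" for p q using that PX diam by blast
  qed (use sep \<epsilon> \<epsilon>0 in auto)
  obtain g where g: "\<And>x. x \<in> X \<Longrightarrow> g x \<in> P \<and> norm (x - g x) \<le> \<epsilon> / 2"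
    using near by metis
  define F where "F p = {x \<in> X. g x = p}" for p
  define w where "w p = real (card (F p))" for p
  have finF [simp]: "finite (F p)" for p using X by (simp add: F_def)
  have "far_pairs \<epsilon> X \<subseteq> (\<Union>p\<in>P. \<Union>q\<in>far p. F p \<times> F q)"
  proof (rule subsetI, clarsimp simp: far_pairs_def F_def)
    fix x y assume xy: "x \<in> X" "y \<in> X" "1 - \<epsilon> \<le> norm (x - y)"
    have "norm (x - y) \<le> norm (x - g x) + norm (g x - g y) + norm (g y - y)"
      using norm_triangle_ineq[of "x - g x" "g x - y"] norm_triangle_ineq[of "g x - g y" "g y - y"] by simp
    then have "g y \<in> far (g x)"
      using xy g[OF xy(1)] g[OF xy(2)] by (simp add: far_def norm_minus_commute)
    then show "g x \<in> P \<and> g y \<in> far (g x)" using g xy by auto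
  qed
  then have "card (far_pairs \<epsilon> X) \<le> card (\<Union>p\<in>P. \<Union>q\<in>far p. F p \<times> F q)"
    using fin by (intro card_mono) auto
  also have "\<dots> \<le> (\<Sum>p\<in>P. card (\<Union>q\<in>far p. F p \<times> F q))"
    by (rule card_UN_le[OF fin])
  also have "\<dots> \<le> (\<Sum>p\<in>P. \<Sum>q\<in>far p. card (F p \<times> F q))"
    by (intro sum_mono card_UN_le) simp
  finally have "real (card (far_pairs \<epsilon> X)) \<le> real (\<Sum>p\<in>P. \<Sum>q\<in>far p. card (F p \<times> F q))"
    by (rule of_nat_mono)
  also have "\<dots> = (\<Sum>p\<in>P. \<Sum>q\<in>far p. w p * w q)"
    by (simp add: w_def card_cartesian_product)
  also have "\<dots> \<le> 120000 / sqrt (2 * \<epsilon>) * (\<Sum>p\<in>P. (w p)\<^sup>2)"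
    by (rule far_form_le)
  also have "\<dots> \<le> 120000 / sqrt \<epsilon> * (64 * (\<epsilon> / \<eta>)\<^sup>2 * card (close_pairs \<eta> X))"
  proof (rule mult_mono)
    show "120000 / sqrt (2 * \<epsilon>) \<le> 120000 / sqrt \<epsilon>"
      using \<epsilon>0 by (intro divide_left_mono) auto
    have "(w p)\<^sup>2 \<le> 64 * (\<epsilon> / \<eta>)\<^sup>2 * real (card (close_pairs \<eta> (F p)))" for p
    proof -
      have "(w p)\<^sup>2 \<le> 16 * (1 + \<epsilon> / \<eta>)\<^sup>2 * real (card (close_pairs \<eta> (F p)))"
        unfolding w_def
      proof (rule card_sq_le_close_pairs[OF _ \<eta>(1)])
        fix x y assume "x \<in> F p" "y \<in> F p"
        then have "norm (x - p) \<le> \<epsilon> / 2" "norm (y - p) \<le> \<epsilon> / 2"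
          using g[of x] g[of y] by (auto simp: F_def)
        then show "norm (x - y) \<le> \<epsilon>" using norm_triangle_ineq4[of "x - p" "y - p"] by simp
      qed simp
      also have "\<dots> \<le> 16 * (2 * (\<epsilon> / \<eta>))\<^sup>2 * real (card (close_pairs \<eta> (F p)))"
        using \<eta> by (intro mult_right_mono mult_left_mono power_mono) (auto simp: field_simps)
      finally show ?thesis unfolding power_mult_distrib by simp
    qed
    then have "(\<Sum>p\<in>P. (w p)\<^sup>2) \<le> (\<Sum>p\<in>P. 64 * (\<epsilon> / \<eta>)\<^sup>2 * real (card (close_pairs \<eta> (F p))))"
      by (intro sum_mono)
    also have "\<dots> = 64 * (\<epsilon> / \<eta>)\<^sup>2 * real (\<Sum>p\<in>P. card (close_pairs \<eta> (F p)))"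
      by (simp add: sum_distrib_left)
    also have "\<dots> \<le> 64 * (\<epsilon> / \<eta>)\<^sup>2 * real (card (close_pairs \<eta> X))"
      unfolding F_def using sum_card_close_pairs_fibres_le[OF X fin]
      by (intro mult_left_mono of_nat_mono) auto
    finally show "(\<Sum>p\<in>P. (w p)\<^sup>2) \<le> 64 * (\<epsilon> / \<eta>)\<^sup>2 * real (card (close_pairs \<eta> X))" .
  qed (use \<epsilon>0 in \<open>auto intro: sum_nonneg\<close>)
  also have "\<dots> = 7680000 * (\<epsilon>\<^sup>2 / sqrt \<epsilon>) / \<eta>\<^sup>2 * card (close_pairs \<eta> X)"
    by (simp add: power_divide)
  finally show ?thesis unfolding sq_over_sqrt[OF \<epsilon>0] .
qed

lemma card_sq_le_close_pairs_unit:
  fixes X :: "(real^2) set"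
  assumes X: "finite X" and diam: "\<And>x y. x \<in> X \<Longrightarrow> y \<in> X \<Longrightarrow> norm (x - y) \<le> 1"
    and \<eta>: "0 < \<eta>" "\<eta> \<le> 1"
  shows "(real (card X))\<^sup>2 \<le> 64 / \<eta>\<^sup>2 * card (close_pairs \<eta> X)"
proof -
  have "(real (card X))\<^sup>2 \<le> 16 * (1 + 1 / \<eta>)\<^sup>2 * card (close_pairs \<eta> X)"
    by (rule card_sq_le_close_pairs[OF X \<eta>(1) diam])
  also have "\<dots> \<le> 16 * (2 / \<eta>)\<^sup>2 * card (close_pairs \<eta> X)"
    using \<eta> by (intro mult_right_mono mult_left_mono power_mono) (auto simp: field_simps)
  finally show ?thesis by (simp add: power_divide)
qed

text \<open>Once \<open>\<epsilon>\<close> is bounded below, comparing both sides with \<open>(card X)\<^sup>2\<close> suffices.\<close>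

lemma card_far_pairs_le:
  assumes X: "finite X" and diam: "\<And>x y. x \<in> X \<Longrightarrow> y \<in> X \<Longrightarrow> norm (x - y) \<le> 1"
    and \<eta>: "0 < \<eta>" "\<eta> \<le> \<epsilon>" and \<epsilon>: "\<epsilon> < 1"
  shows "real (card (far_pairs \<epsilon> X)) \<le> 7680000 * \<epsilon> powr (3/2) / \<eta>\<^sup>2 * card (close_pairs \<eta> X)"
proof (cases "\<epsilon> \<le> 1/20")
  case True
  then show ?thesis using card_far_pairs_le_small[OF X diam \<eta>] by simp
next
  case False
  have "card (far_pairs \<epsilon> X) \<le> card (X \<times> X)"
    using X by (intro card_mono) (auto simp: far_pairs_def)
  then have "real (card (far_pairs \<epsilon> X)) \<le> (real (card X))\<^sup>2"
    unfolding card_cartesian_product power2_eq_square by (metis of_nat_le_iff of_nat_mult)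
  also have "\<dots> \<le> 64 / \<eta>\<^sup>2 * card (close_pairs \<eta> X)"
    using card_sq_le_close_pairs_unit[OF X diam \<eta>(1)] \<eta> \<epsilon> by simp
  also have "\<dots> \<le> 7680000 * \<epsilon> powr (3/2) / \<eta>\<^sup>2 * card (close_pairs \<eta> X)"
  proof -
    have "(1/20)\<^sup>2 \<le> \<epsilon>\<^sup>2" using False by (intro power_mono) auto
    also have "\<epsilon>\<^sup>2 = \<epsilon> powr 2" using False by simp
    also have "\<dots> \<le> \<epsilon> powr (3/2)" using False \<epsilon> by (intro powr_mono') auto
    finally have "64 \<le> 7680000 * \<epsilon> powr (3/2)" by (simp add: power2_eq_square)
    then show ?thesis by (intro mult_right_mono divide_right_mono) auto
  qed
  finally show ?thesis .
qed

lemma card_antipodal_pairs_le_far_pairs: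
  assumes "finite X"
  shows "card (antipodal_pairs \<epsilon> X) \<le> card (far_pairs \<epsilon> X)"
proof -
  have "antipodal_pairs \<epsilon> X \<subseteq> (\<lambda>(x, y). {x, y}) ` far_pairs \<epsilon> X"
    by (auto simp: antipodal_pairs_def far_pairs_def)
  then have "card (antipodal_pairs \<epsilon> X) \<le> card ((\<lambda>(x, y). {x, y}) ` far_pairs \<epsilon> X)"
    using assms by (intro card_mono) auto
  also have "\<dots> \<le> card (far_pairs \<epsilon> X)" using assms by (intro card_image_le) auto
  finally show ?thesis .
qed

lemma card_close_pairs_le_card_plus_neighboring:
  assumes X: "finite X"
  shows "card (close_pairs \<eta> X) \<le> card X + 2 * card (neighboring_pairs \<eta> X)"
proof -
  let ?N = "neighboring_pairs \<eta> X"
  have finN: "finite ?N"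
    using X by (intro finite_subset[of ?N "Pow X"]) (auto simp: neighboring_pairs_def)
  have two: "finite {(x, y). {x, y} = e} \<and> card {(x, y). {x, y} = e} \<le> 2" if eN: "e \<in> ?N" for e
  proof -
    obtain a b where e: "e = {a, b}" using eN by (auto simp: neighboring_pairs_def)
    have pairs: "{(x, y). {x, y} = e} = {(a, b), (b, a)}" unfolding e by (auto simp: doubleton_eq_iff)
    show ?thesis unfolding pairs by (intro conjI finite.intros card_insert_le_m1) simp_all
  qed
  have "close_pairs \<eta> X \<subseteq> (\<lambda>x. (x, x)) ` X \<union> (\<Union>e\<in>?N. {(x, y). {x, y} = e})"
  proof (rule subsetI)
    fix z assume "z \<in> close_pairs \<eta> X"
    then obtain x y where z: "z = (x, y)" "x \<in> X" "y \<in> X" "norm (x - y) \<le> \<eta>"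
      by (auto simp: close_pairs_def)
    show "z \<in> (\<lambda>x. (x, x)) ` X \<union> (\<Union>e\<in>?N. {(x, y). {x, y} = e})"
    proof (cases "x = y")
      case False
      then have "{x, y} \<in> ?N" unfolding neighboring_pairs_def using z by blast
      then show ?thesis using z(1) by blast
    qed (use z in simp)
  qed
  then have "card (close_pairs \<eta> X) \<le> card ((\<lambda>x. (x, x)) ` X \<union> (\<Union>e\<in>?N. {(x, y). {x, y} = e}))"
    using X finN two by (intro card_mono) auto
  also have "\<dots> \<le> card ((\<lambda>x. (x, x)) ` X) + card (\<Union>e\<in>?N. {(x, y). {x, y} = e})"
    by (rule card_Un_le)
  also have "\<dots> \<le> card X + (\<Sum>e\<in>?N. card {(x, y). {x, y} = e})"
    using X finN by (intro add_mono card_image_le card_UN_le)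
  also have "\<dots> \<le> card X + (\<Sum>e\<in>?N. 2)"
    using two by (intro add_left_mono sum_mono) auto
  finally show ?thesis by simp
qed

text \<open>The lower bound on \<open>card X\<close> makes the average grid cell hold many points, so that the diagonal
  contributes at most half of all close pairs.\<close>

lemma card_close_pairs_le_neighboring:
  assumes X: "finite X" and diam: "\<And>x y. x \<in> X \<Longrightarrow> y \<in> X \<Longrightarrow> norm (x - y) \<le> 1"
    and \<eta>: "0 < \<eta>" "\<eta> \<le> 1" and big: "128 / \<eta>\<^sup>2 \<le> card X"
  shows "real (card (close_pairs \<eta> X)) \<le> 4 * card (neighboring_pairs \<eta> X)"
proof -
  have "128 / \<eta>\<^sup>2 * card X \<le> (real (card X))\<^sup>2"
    using mult_right_mono[OF big, of "real (card X)"] by (simp add: power2_eq_square)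
  also have "\<dots> \<le> 64 / \<eta>\<^sup>2 * card (close_pairs \<eta> X)"
    by (rule card_sq_le_close_pairs_unit[OF X diam \<eta>])
  finally have "2 * card X \<le> card (close_pairs \<eta> X)"
    using \<eta> by (simp add: divide_le_cancel)
  then show ?thesis using card_close_pairs_le_card_plus_neighboring[OF X, of \<eta>] by linarith
qed

lemma card_neighboring_pairs_ge:
  assumes X: "finite X" and diam: "\<And>x y. x \<in> X \<Longrightarrow> y \<in> X \<Longrightarrow> norm (x - y) \<le> 1"
    and \<eta>: "0 < \<eta>" "\<eta> \<le> \<epsilon>" and \<epsilon>: "\<epsilon> < 1" and big: "128 / \<eta>\<^sup>2 \<le> card X"
  shows "1 / 30720000 * \<eta>\<^sup>2 * \<epsilon> powr (-3/2) * card (antipodal_pairs \<epsilon> X) \<le> card (neighboring_pairs \<eta> X)"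
proof -
  have "real (card (antipodal_pairs \<epsilon> X)) \<le> card (far_pairs \<epsilon> X)"
    using card_antipodal_pairs_le_far_pairs[OF X] by simp
  also have "\<dots> \<le> 7680000 * \<epsilon> powr (3/2) / \<eta>\<^sup>2 * card (close_pairs \<eta> X)"
    by (rule card_far_pairs_le[OF X diam \<eta> \<epsilon>])
  also have "\<dots> \<le> 7680000 * \<epsilon> powr (3/2) / \<eta>\<^sup>2 * (4 * card (neighboring_pairs \<eta> X))"
    using card_close_pairs_le_neighboring[OF X diam \<eta>(1) _ big] \<eta> \<epsilon> by (intro mult_left_mono) auto
  finally have "real (card (antipodal_pairs \<epsilon> X)) \<le>
    30720000 * \<epsilon> powr (3/2) / \<eta>\<^sup>2 * card (neighboring_pairs \<eta> X)" by simp
  then have "\<eta>\<^sup>2 * card (antipodal_pairs \<epsilon> X) \<le> 30720000 * \<epsilon> powr (3/2) * card (neighboring_pairs \<eta> X)"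
    using \<eta> by (simp add: field_simps)
  moreover have "0 < \<epsilon> powr (3/2)" using \<eta> by simp
  ultimately show ?thesis by (simp add: powr_minus field_simps)
qed

lemma antipodal_pairs_mono: "\<epsilon> \<le> \<epsilon>' \<Longrightarrow> antipodal_pairs \<epsilon> X \<subseteq> antipodal_pairs \<epsilon>' X"
  unfolding antipodal_pairs_def by fastforce

lemma finite_antipodal_pairs: "finite X \<Longrightarrow> finite (antipodal_pairs \<epsilon> X)"
  by (rule finite_subset[of _ "Pow X"]) (auto simp: antipodal_pairs_def)

theorem theorem1p4:
  shows "\<exists>c\<^sub>1 c\<^sub>2 :: real. c\<^sub>1 > 0 \<and> c\<^sub>2 > 0 \<and>
    (\<forall>(\<epsilon>\<^sub>1::real) (\<epsilon>\<^sub>2::real) (X :: (real^2) set).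
      0 < \<epsilon>\<^sub>1 \<longrightarrow> \<epsilon>\<^sub>1 < 1 \<longrightarrow> 0 < \<epsilon>\<^sub>2 \<longrightarrow> \<epsilon>\<^sub>2 < 1 \<longrightarrow>
      finite X \<longrightarrow> diameter X \<le> 1 \<longrightarrow> real (card X) \<ge> c\<^sub>1 * \<epsilon>\<^sub>1 powr (-2) \<longrightarrow>
      real (card (neighboring_pairs \<epsilon>\<^sub>1 X)) \<ge>
        (if \<epsilon>\<^sub>1 \<le> \<epsilon>\<^sub>2
         then c\<^sub>2 * \<epsilon>\<^sub>1\<^sup>2 * \<epsilon>\<^sub>2 powr (-3/2) * real (card (antipodal_pairs \<epsilon>\<^sub>2 X))
         else c\<^sub>2 * \<epsilon>\<^sub>1 powr (1/2) * real (card (antipodal_pairs \<epsilon>\<^sub>2 X))))"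
proof (rule exI[of _ 128], rule exI[of _ "1 / 30720000"], intro conjI allI impI)
  fix \<epsilon>\<^sub>1 \<epsilon>\<^sub>2 :: real and X :: "(real^2) set"
  assume e: "0 < \<epsilon>\<^sub>1" "\<epsilon>\<^sub>1 < 1" "0 < \<epsilon>\<^sub>2" "\<epsilon>\<^sub>2 < 1" and X: "finite X"
    and d: "diameter X \<le> 1" and c: "real (card X) \<ge> 128 * \<epsilon>\<^sub>1 powr (-2)"
  have diam: "norm (x - y) \<le> 1" if "x \<in> X" "y \<in> X" for x y
    using diameter_bounded_bound[OF finite_imp_bounded[OF X] that] d by (simp add: dist_norm)
  have big: "128 / \<epsilon>\<^sub>1\<^sup>2 \<le> card X" using c e by (simp add: powr_minus divide_inverse)
  show "real (card (neighboring_pairs \<epsilon>\<^sub>1 X)) \<ge>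
        (if \<epsilon>\<^sub>1 \<le> \<epsilon>\<^sub>2
         then 1 / 30720000 * \<epsilon>\<^sub>1\<^sup>2 * \<epsilon>\<^sub>2 powr (-3/2) * real (card (antipodal_pairs \<epsilon>\<^sub>2 X))
         else 1 / 30720000 * \<epsilon>\<^sub>1 powr (1/2) * real (card (antipodal_pairs \<epsilon>\<^sub>2 X)))"
  proof (cases "\<epsilon>\<^sub>1 \<le> \<epsilon>\<^sub>2")
    case True
    then show ?thesis using card_neighboring_pairs_ge[OF X diam e(1) True e(4) big] by simp
  next
    case False
    \<comment> \<open>the bound for equal parameters, since enlarging \<open>\<epsilon>\<^sub>2\<close> to \<open>\<epsilon>\<^sub>1\<close> only adds antipodal pairs\<close>
    have "card (antipodal_pairs \<epsilon>\<^sub>2 X) \<le> card (antipodal_pairs \<epsilon>\<^sub>1 X)"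
      using False X by (intro card_mono finite_antipodal_pairs antipodal_pairs_mono) auto
    then have "1 / 30720000 * \<epsilon>\<^sub>1 powr (1/2) * real (card (antipodal_pairs \<epsilon>\<^sub>2 X))
      \<le> 1 / 30720000 * \<epsilon>\<^sub>1 powr (1/2) * real (card (antipodal_pairs \<epsilon>\<^sub>1 X))"
      by (intro mult_left_mono) auto
    also have "\<dots> \<le> card (neighboring_pairs \<epsilon>\<^sub>1 X)"
    proof -
      have "\<epsilon>\<^sub>1 powr (1/2) = \<epsilon>\<^sub>1\<^sup>2 * \<epsilon>\<^sub>1 powr (-3/2)"
        using powr_add[of \<epsilon>\<^sub>1 2 "-3/2"] e by simp
      then show ?thesis
        using card_neighboring_pairs_ge[OF X diam e(1) order_refl e(2) big] by (simp add: mult.assoc)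
    qed
    finally show ?thesis using False by simp
  qed
qed auto

end
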